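(* For any $\aleph_0$-space $X$ and each metrizable space $Y$ the function space $C_k(X,Y)$ is a paracompact $\mathfrak P$-space.
   Context: All topological spaces are regular $T_1$-spaces. $C_k(X,Y)$ is the set of all continuous functions $X\to Y$ endowed with the compact-open topology. A family $\mathcal N$ of subsets of a space $X$ is a $k$-network if for any open $U\subset X$ and compact $K\subset U$ there is a finite subfamily $\mathcal F\subset\mathcal N$ with $K\subset\bigcup\mathcal F\subset U$. A (regular) space is an $\aleph_0$-space if it has a countable $k$-network. A family $\mathcal N$ of subsets of a space $X$ is a $cp$-network if for any point $x\in X$, each neighborhood $O_x\subset X$ of $x$ and every subset $A\subset X$ containing $x$ in its closure, there exists $N\in\mathcal N$ such that $x\in N\subset O_x$ and moreover $N\cap A$ is infinite if $A$ accumulates at $x$ (i.e. if every neighborhood of $x$ contains infinitely many points of $A$). A $\mathfrak P$-space is a regular space that has a $\sigma$-locally finite $cp$-network (a $cp$-network which is a countable union of locally finite families). *)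

theory Defs
  imports "HOL-Analysis.Analysis"
begin

text \<open>Points of the function space are the continuous maps that are extensional on
  \<open>topspace X\<close>, so that each continuous function corresponds to exactly one point.\<close>

definition cont_maps :: "'a topology \<Rightarrow> 'b topology \<Rightarrow> ('a \<Rightarrow> 'b) set" where
  "cont_maps X Y = {f \<in> extensional (topspace X). continuous_map X Y f}"

definition compact_open_topology :: "'a topology \<Rightarrow> 'b topology \<Rightarrow> ('a \<Rightarrow> 'b) topology" where
  "compact_open_topology X Y =
     topology_generated_by
       {{f \<in> cont_maps X Y. f ` K \<subseteq> U} | K U. compactin X K \<and> openin Y U}"

lemma topspace_compact_open_topology [simp]:
  "topspace (compact_open_topology X Y) = cont_maps X Y"
proof -
  have "\<exists>K U. cont_maps X Y = {f \<in> cont_maps X Y. f ` K \<subseteq> U} \<and> compactin X K \<and> openin Y U"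
    by (rule exI[of _ "{}"], rule exI[of _ "{}"]) auto
  then show ?thesis
    unfolding compact_open_topology_def topology_generated_by_topspace by blast
qed

definition k_network :: "'a topology \<Rightarrow> 'a set set \<Rightarrow> bool" where
  "k_network X \<N> \<longleftrightarrow>
     \<N> \<subseteq> Pow (topspace X) \<and>
     (\<forall>U K. openin X U \<and> compactin X K \<and> K \<subseteq> U \<longrightarrow>
        (\<exists>\<F>. finite \<F> \<and> \<F> \<subseteq> \<N> \<and> K \<subseteq> \<Union>\<F> \<and> \<Union>\<F> \<subseteq> U))"

definition aleph0_space :: "'a topology \<Rightarrow> bool" where
  "aleph0_space X \<longleftrightarrow>
     regular_space X \<and> t1_space X \<and> (\<exists>\<N>. countable \<N> \<and> k_network X \<N>)"

definition nbhd_of :: "'a topology \<Rightarrow> 'a \<Rightarrow> 'a set \<Rightarrow> bool" where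
  "nbhd_of X x W \<longleftrightarrow> W \<subseteq> topspace X \<and> (\<exists>U. openin X U \<and> x \<in> U \<and> U \<subseteq> W)"

definition accumulates_at :: "'a topology \<Rightarrow> 'a set \<Rightarrow> 'a \<Rightarrow> bool" where
  "accumulates_at X A x \<longleftrightarrow> (\<forall>W. nbhd_of X x W \<longrightarrow> infinite (W \<inter> A))"

definition cp_network :: "'a topology \<Rightarrow> 'a set set \<Rightarrow> bool" where
  "cp_network X \<N> \<longleftrightarrow>
     \<N> \<subseteq> Pow (topspace X) \<and>
     (\<forall>x \<in> topspace X. \<forall>W A. nbhd_of X x W \<and> A \<subseteq> topspace X \<and> x \<in> X closure_of A \<longrightarrow>
        (\<exists>N \<in> \<N>. x \<in> N \<and> N \<subseteq> W \<and> (accumulates_at X A x \<longrightarrow> infinite (N \<inter> A))))"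

definition sigma_locally_finite_in :: "'a topology \<Rightarrow> 'a set set \<Rightarrow> bool" where
  "sigma_locally_finite_in X \<N> \<longleftrightarrow>
     (\<exists>\<A> :: nat \<Rightarrow> 'a set set. (\<forall>n. locally_finite_in X (\<A> n)) \<and> \<N> = (\<Union>n. \<A> n))"

definition P_space :: "'a topology \<Rightarrow> bool" where
  "P_space X \<longleftrightarrow>
     regular_space X \<and> t1_space X \<and> (\<exists>\<N>. cp_network X \<N> \<and> sigma_locally_finite_in X \<N>)"

text \<open>As is customary, the Hausdorff property is part of paracompactness.\<close>

definition paracompact_space :: "'a topology \<Rightarrow> bool" where
  "paracompact_space X \<longleftrightarrow>
     Hausdorff_space X \<and>
     (\<forall>\<U>. (\<forall>U \<in> \<U>. openin X U) \<and> \<Union>\<U> = topspace X \<longrightarrow>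
        (\<exists>\<V>. (\<forall>V \<in> \<V>. openin X V) \<and> \<Union>\<V> = topspace X \<and>
             (\<forall>V \<in> \<V>. \<exists>U \<in> \<U>. V \<subseteq> U) \<and> locally_finite_in X \<V>))"

end

theory Submission
  imports Defs
begin

text \<open>
  Let \<open>B j\<close> be locally finite open families that together form a base of \<open>Y\<close> (Stone), and let \<open>\<E>\<close> be
  the finite intersections of finite unions of members of a countable \<open>k\<close>-network of \<open>X\<close>. Finite
  intersections of sets \<open>{f. f ` N \<subseteq> b}\<close> with \<open>N \<in> \<E>\<close> and \<open>b \<in> B j\<close> form a \<open>\<sigma>\<close>-locally finite network of
  the function space: fixing \<open>x \<in> N\<close>, the open sets \<open>{f. f x \<in> b}\<close> for \<open>b \<in> B j\<close> are already locally
  finite. These open expansions turn the network into \<open>\<sigma>\<close>-locally finite open refinements of open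
  covers, and Michael's theorem gives paracompactness. For the \<open>cp\<close>-property, each compact \<open>K\<close> is the
  limit of a decreasing sequence in \<open>\<E>\<close>; a failure along this sequence yields points converging to \<open>K\<close>
  which can be adjoined to \<open>K\<close>, contradicting accumulation.
\<close>

section \<open>Indexed locally finite families, covers and refinements\<close>

text \<open>Finiteness is required of the set of indices rather than of the set of values. Different
  indices carrying the same set are counted separately, so each \<open>F i\<close> may be replaced
  by any subset depending on \<open>i\<close> without losing local finiteness.\<close>

definition locally_finite_family :: "'a topology \<Rightarrow> 'i set \<Rightarrow> ('i \<Rightarrow> 'a set) \<Rightarrow> bool" where
  "locally_finite_family X I F \<longleftrightarrow>
     (\<forall>i\<in>I. F i \<subseteq> topspace X) \<and>
     (\<forall>x\<in>topspace X. \<exists>V. openin X V \<and> x \<in> V \<and> finite {i\<in>I. F i \<inter> V \<noteq> {}})"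

definition open_cover :: "'a topology \<Rightarrow> 'a set set \<Rightarrow> bool" where
  "open_cover X \<U> \<longleftrightarrow> (\<forall>U\<in>\<U>. openin X U) \<and> \<Union>\<U> = topspace X"

definition refines_cover :: "'a set set \<Rightarrow> 'a set set \<Rightarrow> bool" where
  "refines_cover \<V> \<U> \<longleftrightarrow> (\<forall>V\<in>\<V>. \<exists>U\<in>\<U>. V \<subseteq> U)"

lemma refines_cover_trans: "refines_cover \<A> \<B> \<Longrightarrow> refines_cover \<B> \<C> \<Longrightarrow> refines_cover \<A> \<C>"
  unfolding refines_cover_def by (meson order_trans)

lemma open_coverE:
  assumes "open_cover X \<U>" "x \<in> topspace X"
  obtains U where "U \<in> \<U>" "x \<in> U" "openin X U"
proof -
  have "x \<in> \<Union>\<U>"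
    using assms by (simp add: open_cover_def)
  then show thesis
    using assms that by (auto simp: open_cover_def)
qed

lemma regular_space_closed_nbhd:
  assumes "regular_space X" "openin X U" "x \<in> U"
  obtains W where "openin X W" "x \<in> W" "X closure_of W \<subseteq> U"
proof -
  have "neighbourhood_base_of (closedin X) X"
    using assms(1) by (simp add: neighbourhood_base_of_closedin)
  then obtain W C where "openin X W" "closedin X C" "x \<in> W" "W \<subseteq> C" "C \<subseteq> U"
    using assms(2,3) unfolding neighbourhood_base_of by meson
  then show thesis
    using that closure_of_minimal[of W C X] by blast
qed

lemma locally_finite_family_image:
  assumes "locally_finite_family X I F" and "\<And>i. i \<in> I \<Longrightarrow> G i \<subseteq> F i"
  shows "locally_finite_in X (G ` I)"
  unfolding locally_finite_in_def
proof (intro conjI ballI)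
  show "\<Union>(G ` I) \<subseteq> topspace X"
    using assms unfolding locally_finite_family_def by fast
  fix x assume "x \<in> topspace X"
  then obtain V where V: "openin X V" "x \<in> V" and fin: "finite {i\<in>I. F i \<inter> V \<noteq> {}}"
    using assms(1) unfolding locally_finite_family_def by blast
  have "{U \<in> G ` I. U \<inter> V \<noteq> {}} \<subseteq> G ` {i\<in>I. F i \<inter> V \<noteq> {}}"
    using assms(2) by fast
  then have "finite {U \<in> G ` I. U \<inter> V \<noteq> {}}"
    using fin finite_surj by blast
  then show "\<exists>V. openin X V \<and> x \<in> V \<and> finite {U \<in> G ` I. U \<inter> V \<noteq> {}}"
    using V by blast
qed

section \<open>Stone's theorem: a \<open>\<sigma>\<close>-locally finite base\<close>

text \<open>The strict part of a well-order of the whole type. It is used to single out, for a given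
  point, the first centre whose ball contains that point.\<close>

lemma exists_wf_total: "\<exists>R :: ('a \<times> 'a) set. wf R \<and> (\<forall>x y. x \<noteq> y \<longrightarrow> (x, y) \<in> R \<or> (y, x) \<in> R)"
proof -
  obtain r :: "'a rel" where "well_order_on UNIV r"
    using well_order_on by blast
  then show ?thesis
    unfolding well_order_on_def linear_order_on_def total_on_def
    by (intro exI[of _ "r - Id"]) auto
qed

text \<open>Stone's construction. A point is assigned to the first centre \<open>y\<close> whose
  \<open>\<epsilon>\<close>-ball contains it, and level \<open>n\<close> keeps only those points
  around which the ball of radius \<open>\<delta> n\<close> still fits into that
  \<open>\<epsilon>\<close>-ball. Points kept for different centres are at least
  \<open>\<delta> n\<close> apart, so their thickenings by \<open>\<delta> n / 3\<close> form a
  discrete family.\<close>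

lemma (in Metric_space) sigma_locally_finite_ball_refinement:
  assumes "\<epsilon> > 0"
  obtains \<V> :: "nat \<Rightarrow> 'a set set" where
    "\<And>n. locally_finite_in mtopology (\<V> n)"
    "\<And>n V. V \<in> \<V> n \<Longrightarrow> openin mtopology V"
    "\<And>n V. V \<in> \<V> n \<Longrightarrow> \<exists>y\<in>M. V \<subseteq> mball y \<epsilon>"
    "\<And>x. x \<in> M \<Longrightarrow> \<exists>n. \<exists>V\<in>\<V> n. x \<in> V"
proof -
  obtain R :: "('a \<times> 'a) set" where "wf R \<and> (\<forall>x y. x \<noteq> y \<longrightarrow> (x, y) \<in> R \<or> (y, x) \<in> R)"
    using exists_wf_total ..
  then have R: "wf R" "\<And>x y. x \<noteq> y \<Longrightarrow> (x, y) \<in> R \<or> (y, x) \<in> R"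
    by simp_all
  define \<delta> :: "nat \<Rightarrow> real" where "\<delta> n = inverse (real (Suc n))" for n
  have \<delta>: "\<delta> n > 0" for n
    by (simp add: \<delta>_def)
  define S where "S n y = {x \<in> M. mball x (\<delta> n) \<subseteq> mball y \<epsilon> \<and>
      (\<forall>z\<in>M. (z, y) \<in> R \<longrightarrow> x \<notin> mball z \<epsilon>)}" for n y
  define E where "E n y = (\<Union>x\<in>S n y. mball x (\<delta> n / 3))" for n y
  \<comment> \<open>The ball of radius \<open>\<delta> n\<close> about \<open>x\<close> lies in the
    \<open>\<epsilon>\<close>-ball of the earlier centre \<open>y\<close>, and \<open>x'\<close>
    avoids that ball because it was assigned to the later centre \<open>y'\<close>.\<close>
  have far: "d x x' \<ge> \<delta> n"
    if "x \<in> S n y" "x' \<in> S n y'" "y \<in> M" "(y, y') \<in> R" for x x' y y' n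
  proof (rule ccontr)
    assume "\<not> ?thesis"
    then have "x' \<in> mball x (\<delta> n)"
      using that by (auto simp: S_def in_mball)
    then show False
      using that by (auto simp: S_def)
  qed
  show thesis
  proof (rule that[of "\<lambda>n. E n ` M"])
    fix n
    show "locally_finite_in mtopology (E n ` M)"
      unfolding locally_finite_in_def topspace_mtopology
    proof (intro conjI ballI)
      show "\<Union>(E n ` M) \<subseteq> M"
        by (auto simp: E_def in_mball)
      fix p assume p: "p \<in> M"
      \<comment> \<open>Since \<open>1/3 + 1/6 = 1/2\<close>, any set \<open>E n y\<close> meeting
        this ball has a point of \<open>S n y\<close> at distance less than
        \<open>\<delta> n / 2\<close> from \<open>p\<close>. Two such points are less than
        \<open>\<delta> n\<close> apart, so by \<open>far\<close> only one centre is
        possible.\<close>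
      let ?V = "mball p (\<delta> n / 6)"
      have near: "\<exists>x\<in>S n y. d x p < \<delta> n / 2" if "E n y \<inter> ?V \<noteq> {}" for y
      proof -
        obtain x q where x: "x \<in> S n y" and q: "q \<in> mball x (\<delta> n / 3)" "q \<in> ?V"
          using \<open>E n y \<inter> ?V \<noteq> {}\<close> unfolding E_def by blast
        have "d x p \<le> d x q + d q p"
          using q p by (intro triangle) (auto simp: in_mball)
        also have "\<dots> < \<delta> n / 3 + \<delta> n / 6"
          using q by (intro add_strict_mono) (auto simp: in_mball commute)
        finally show ?thesis
          using x by (intro bexI[of _ x]) auto
      qed
      have eq: "y = y'" if yy: "y \<in> M" "y' \<in> M" "E n y \<inter> ?V \<noteq> {}" "E n y' \<inter> ?V \<noteq> {}" for y y'
      proof (rule ccontr)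
        assume "y \<noteq> y'"
        obtain x x' where x: "x \<in> S n y" "d x p < \<delta> n / 2" and x': "x' \<in> S n y'" "d x' p < \<delta> n / 2"
          using near yy by blast
        have "d x x' \<le> d x p + d p x'"
          using x x' p by (intro triangle) (auto simp: S_def)
        also have "\<dots> < \<delta> n"
          using x x' commute[of p x'] by linarith
        finally have "d x x' < \<delta> n" .
        then show False
          using R(2)[OF \<open>y \<noteq> y'\<close>] far[OF x(1) x'(1)] far[OF x'(1) x(1)] yy commute[of x x'] by force
      qed
      have "finite {U \<in> E n ` M. U \<inter> ?V \<noteq> {}}"
      proof (cases "\<exists>y\<in>M. E n y \<inter> ?V \<noteq> {}")
        case True
        then obtain y where "y \<in> M" "E n y \<inter> ?V \<noteq> {}"
          by blast
        then have "{U \<in> E n ` M. U \<inter> ?V \<noteq> {}} \<subseteq> {E n y}"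
          using eq by blast
        then show ?thesis
          by (meson finite.simps finite_subset)
      next
        case False
        then have "{U \<in> E n ` M. U \<inter> ?V \<noteq> {}} = {}"
          by blast
        then show ?thesis
          by (metis finite.emptyI)
      qed
      then show "\<exists>V. openin mtopology V \<and> p \<in> V \<and> finite {U \<in> E n ` M. U \<inter> V \<noteq> {}}"
        using p \<delta>[of n] by (intro exI[of _ ?V]) auto
    qed
  next
    fix n V assume V: "V \<in> E n ` M"
    then show "openin mtopology V"
      by (auto simp: E_def)
    obtain y where y: "y \<in> M" "V = E n y"
      using V by blast
    have "mball x (\<delta> n / 3) \<subseteq> mball y \<epsilon>" if "x \<in> S n y" for x
    proof -
      have "mball x (\<delta> n / 3) \<subseteq> mball x (\<delta> n)"
        using \<delta>[of n] by (intro mball_subset_concentric) auto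
      then show ?thesis
        using that by (auto simp: S_def)
    qed
    then show "\<exists>y\<in>M. V \<subseteq> mball y \<epsilon>"
      using y by (auto simp: E_def)
  next
    fix x assume x: "x \<in> M"
    then have ex: "x \<in> {y \<in> M. x \<in> mball y \<epsilon>}"
      using assms by simp
    obtain y where y: "y \<in> {y \<in> M. x \<in> mball y \<epsilon>}"
      and min: "\<And>z. (z, y) \<in> R \<Longrightarrow> z \<notin> {y \<in> M. x \<in> mball y \<epsilon>}"
      using R(1)[unfolded wf_eq_minimal, rule_format, OF ex] by blast
    have "openin mtopology (mball y \<epsilon>)"
      by simp
    then obtain r where r: "r > 0" "mball x r \<subseteq> mball y \<epsilon>"
      using y unfolding openin_mtopology by blast
    obtain n where n: "\<delta> n < r"
      using reals_Archimedean[OF r(1)] by (auto simp: \<delta>_def)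
    have "mball x (\<delta> n) \<subseteq> mball x r"
      using n by (intro mball_subset_concentric) auto
    then have "x \<in> S n y"
      using x r min by (auto simp: S_def)
    then have "x \<in> E n y"
      using x \<delta>[of n] unfolding E_def by (intro UN_I[of x]) auto
    then show "\<exists>n. \<exists>V\<in>E n ` M. x \<in> V"
      using y by blast
  qed
qed

text \<open>The base consists of the refinements of the covers by balls of radius
  \<open>1/(k+1)\<close>, for all \<open>k\<close>. The double index (radius, level) is coded by a
  single natural number.\<close>

lemma metrizable_space_sigma_locally_finite_base:
  assumes "metrizable_space Y"
  obtains B :: "nat \<Rightarrow> 'b set set" where
    "\<And>j. locally_finite_in Y (B j)"
    "\<And>j b. b \<in> B j \<Longrightarrow> openin Y b"
    "\<And>U y. openin Y U \<Longrightarrow> y \<in> U \<Longrightarrow> \<exists>j. \<exists>b\<in>B j. y \<in> b \<and> b \<subseteq> U"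
proof -
  obtain M d where "Metric_space M d" and Y: "Y = Metric_space.mtopology M d"
    using assms unfolding metrizable_space_def by blast
  then interpret Metric_space M d by simp
  have "\<exists>\<V> :: nat \<Rightarrow> 'b set set. \<forall>n. locally_finite_in Y (\<V> n) \<and> (\<forall>V\<in>\<V> n. openin Y V \<and>
      (\<exists>y\<in>M. V \<subseteq> mball y (inverse (real (Suc k))))) \<and> (\<forall>x\<in>M. \<exists>n. \<exists>V\<in>\<V> n. x \<in> V)" for k
  proof (rule sigma_locally_finite_ball_refinement[of "inverse (real (Suc k))"])
    fix \<V> :: "nat \<Rightarrow> 'b set set"
    assume "\<And>n. locally_finite_in mtopology (\<V> n)" "\<And>n V. V \<in> \<V> n \<Longrightarrow> openin mtopology V"
      "\<And>n V. V \<in> \<V> n \<Longrightarrow> \<exists>y\<in>M. V \<subseteq> mball y (inverse (real (Suc k)))"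
      "\<And>x. x \<in> M \<Longrightarrow> \<exists>n. \<exists>V\<in>\<V> n. x \<in> V"
    then show ?thesis
      unfolding Y by (intro exI[of _ \<V>]) simp
  qed simp
  then obtain \<V> :: "nat \<Rightarrow> nat \<Rightarrow> 'b set set"
    where \<V>: "\<And>k n. locally_finite_in Y (\<V> k n)"
      "\<And>k n V. V \<in> \<V> k n \<Longrightarrow> openin Y V"
      "\<And>k n V. V \<in> \<V> k n \<Longrightarrow> \<exists>y\<in>M. V \<subseteq> mball y (inverse (real (Suc k)))"
      "\<And>k x. x \<in> M \<Longrightarrow> \<exists>n. \<exists>V\<in>\<V> k n. x \<in> V"
    by metis
  show thesis
  proof (rule that[of "\<lambda>j. \<V> (fst (prod_decode j)) (snd (prod_decode j))"])
    fix U y assume U: "openin Y U" "y \<in> U"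
    then obtain r where r: "r > 0" "mball y r \<subseteq> U" and "y \<in> M"
      unfolding Y openin_mtopology by blast
    obtain k where k: "inverse (real (Suc k)) < r / 2"
      using reals_Archimedean[of "r / 2"] r by auto
    obtain n V where V: "V \<in> \<V> k n" "y \<in> V"
      using \<V>(4)[OF \<open>y \<in> M\<close>] by blast
    then obtain z where z: "z \<in> M" "V \<subseteq> mball z (inverse (real (Suc k)))"
      using \<V>(3) by blast
    have "V \<subseteq> mball y r"
    proof
      fix w assume "w \<in> V"
      then have w: "w \<in> M" "d z w < r / 2" and "d z y < r / 2"
        using z(1) k \<open>w \<in> V\<close> V(2) subsetD[OF z(2)] by (fastforce simp: in_mball)+
      then show "w \<in> mball y r"
        using triangle[of y z w] \<open>y \<in> M\<close> z(1) commute[of z y] by (simp add: in_mball)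
    qed
    then show "\<exists>j. \<exists>b\<in>\<V> (fst (prod_decode j)) (snd (prod_decode j)). y \<in> b \<and> b \<subseteq> U"
      using V r by (intro exI[of _ "prod_encode (k, n)"] bexI[of _ V]) auto
  qed (use \<V> in auto)
qed

section \<open>Michael's criterion for paracompactness\<close>

text \<open>From each member of level \<open>n\<close> all earlier levels are subtracted, at the
  price of openness. If \<open>x\<close> lies in \<open>W\<close> of level \<open>m\<close>, then
  inside \<open>W\<close> nothing remains of the levels beyond \<open>m\<close>, and the levels up
  to \<open>m\<close> are controlled by finitely many neighbourhoods \<open>G n\<close>.\<close>

lemma sigma_locally_finite_imp_locally_finite_refinement:
  fixes \<V> :: "nat \<Rightarrow> 'a set set"
  assumes lf: "\<And>n. locally_finite_in X (\<V> n)" and op: "\<And>n V. V \<in> \<V> n \<Longrightarrow> openin X V"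
    and cov: "topspace X \<subseteq> (\<Union>n. \<Union>(\<V> n))"
  obtains \<A> where "locally_finite_in X \<A>" "\<Union>\<A> = topspace X" "refines_cover \<A> (\<Union>n. \<V> n)"
proof -
  define F where "F = (\<lambda>(n, V). V - (\<Union>i<n. \<Union>(\<V> i)))"
  let ?I = "Sigma UNIV \<V>"
  have sub: "F p \<subseteq> topspace X" if "p \<in> ?I" for p
    using that op openin_subset by (fastforce simp: F_def)
  have "locally_finite_family X ?I F"
    unfolding locally_finite_family_def
  proof (intro conjI ballI)
    fix p assume "p \<in> ?I"
    then show "F p \<subseteq> topspace X"
      by (rule sub)
  next
    fix x assume x: "x \<in> topspace X"
    then obtain m W where W: "W \<in> \<V> m" "x \<in> W"
      using cov by blast
    have "\<forall>n. \<exists>G. openin X G \<and> x \<in> G \<and> finite {V \<in> \<V> n. V \<inter> G \<noteq> {}}"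
      using lf x unfolding locally_finite_in_def by blast
    then obtain G where G: "\<And>n. openin X (G n)" "\<And>n. x \<in> G n" "\<And>n. finite {V \<in> \<V> n. V \<inter> G n \<noteq> {}}"
      by metis
    let ?H = "W \<inter> (\<Inter>n\<in>{..m}. G n)"
    have "openin X ?H"
      using W op G by (intro openin_Int openin_INT2) auto
    moreover have "{p \<in> ?I. F p \<inter> ?H \<noteq> {}} \<subseteq> (SIGMA n:{..m}. {V \<in> \<V> n. V \<inter> G n \<noteq> {}})"
    proof (rule subsetI)
      fix p assume p: "p \<in> {p \<in> ?I. F p \<inter> ?H \<noteq> {}}"
      obtain n V where nV: "p = (n, V)"
        by (cases p)
      then have "V \<in> \<V> n" "F (n, V) \<inter> ?H \<noteq> {}"
        using p by auto
      then obtain z where z: "z \<in> V" "\<forall>i<n. z \<notin> \<Union>(\<V> i)" "z \<in> W" "\<forall>i\<le>m. z \<in> G i"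
        by (auto simp: F_def)
      then have "n \<le> m"
        using W by (meson UnionI not_le)
      then show "p \<in> (SIGMA n:{..m}. {V \<in> \<V> n. V \<inter> G n \<noteq> {}})"
        using z \<open>V \<in> \<V> n\<close> nV by auto
    qed
    then have "finite {p \<in> ?I. F p \<inter> ?H \<noteq> {}}"
      by (rule finite_subset) (use G in auto)
    ultimately show "\<exists>V. openin X V \<and> x \<in> V \<and> finite {p \<in> ?I. F p \<inter> V \<noteq> {}}"
      using W G by blast
  qed
  then have "locally_finite_in X (F ` ?I)"
    by (rule locally_finite_family_image) simp
  moreover have "\<Union>(F ` ?I) = topspace X"
  proof
    show "\<Union>(F ` ?I) \<subseteq> topspace X"
      using sub by blast
    show "topspace X \<subseteq> \<Union>(F ` ?I)"
    proof
      fix x assume "x \<in> topspace X"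
      then have ex: "\<exists>n. x \<in> \<Union>(\<V> n)"
        using cov by blast
      \<comment> \<open>In the first level that reaches \<open>x\<close>, the subtraction does not
        remove \<open>x\<close>.\<close>
      define n where "n = (LEAST n. x \<in> \<Union>(\<V> n))"
      have n: "x \<in> \<Union>(\<V> n)"
        unfolding n_def by (rule LeastI_ex[OF ex])
      have "\<forall>i<n. x \<notin> \<Union>(\<V> i)"
        unfolding n_def using not_less_Least by blast
      moreover obtain V where "V \<in> \<V> n" "x \<in> V"
        using n by blast
      ultimately have "x \<in> F (n, V)" "(n, V) \<in> ?I"
        by (auto simp: F_def)
      then show "x \<in> \<Union>(F ` ?I)"
        by blast
    qed
  qed
  moreover have "refines_cover (F ` ?I) (\<Union>n. \<V> n)"
    unfolding refines_cover_def
  proof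
    fix A assume "A \<in> F ` ?I"
    then obtain n V where "A = F (n, V)" "V \<in> \<V> n"
      by blast
    then show "\<exists>U\<in>(\<Union>n. \<V> n). A \<subseteq> U"
      by (intro bexI[of _ V]) (auto simp: F_def)
  qed
  ultimately show thesis
    by (rule that)
qed

text \<open>Regularity gives an open cover by sets whose closures fit into members of
  \<open>\<U>\<close>. A locally finite refinement of it stays locally finite when closures are
  taken.\<close>

lemma regular_space_closed_refinement:
  assumes reg: "regular_space X"
    and lf: "\<And>\<U>. open_cover X \<U> \<Longrightarrow> \<exists>\<A>. locally_finite_in X \<A> \<and> \<Union>\<A> = topspace X \<and> refines_cover \<A> \<U>"
    and \<U>: "open_cover X \<U>"
  obtains \<F> where "locally_finite_in X \<F>" "\<Union>\<F> = topspace X" "refines_cover \<F> \<U>" "\<And>F. F \<in> \<F> \<Longrightarrow> closedin X F"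
proof -
  define \<W> where "\<W> = {W. openin X W \<and> (\<exists>U\<in>\<U>. X closure_of W \<subseteq> U)}"
  have "\<exists>W\<in>\<W>. x \<in> W" if "x \<in> topspace X" for x
  proof -
    obtain U where U: "U \<in> \<U>" "x \<in> U" "openin X U"
      using \<open>x \<in> topspace X\<close> by (rule open_coverE[OF \<U>])
    obtain W where "openin X W" "x \<in> W" "X closure_of W \<subseteq> U"
      by (rule regular_space_closed_nbhd[OF reg U(3,2)])
    then show ?thesis
      using U(1) unfolding \<W>_def by blast
  qed
  then have \<W>: "open_cover X \<W>"
    unfolding open_cover_def using openin_subset by (fastforce simp: \<W>_def)
  obtain \<A> where \<A>: "locally_finite_in X \<A>" "\<Union>\<A> = topspace X" "refines_cover \<A> \<W>"
    using lf[OF \<W>] by blast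
  let ?F = "(\<lambda>A. X closure_of A) ` \<A>"
  show thesis
  proof (rule that)
    show "locally_finite_in X ?F"
      using \<A>(1) by (rule locally_finite_in_closure)
    show "\<Union>?F = topspace X"
    proof
      show "\<Union>?F \<subseteq> topspace X"
        by (simp add: UN_least closure_of_subset_topspace)
      have "A \<subseteq> X closure_of A" if "A \<in> \<A>" for A
        using \<A>(2) that by (intro closure_of_subset) blast
      then show "topspace X \<subseteq> \<Union>?F"
        using \<A>(2) by blast
    qed
    show "refines_cover ?F \<U>"
      unfolding refines_cover_def
    proof
      fix F assume "F \<in> ?F"
      then obtain A W where "F = X closure_of A" "A \<subseteq> W" "W \<in> \<W>"
        using \<A>(3) unfolding refines_cover_def by blast
      then show "\<exists>U\<in>\<U>. F \<subseteq> U"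
        using closure_of_mono[of A W X] unfolding \<W>_def by blast
    qed
  qed auto
qed

text \<open>Michael's expansion argument. The members of a locally finite refinement
  \<open>\<A>\<close> are enlarged to open sets with the help of a locally finite closed cover
  \<open>\<F>\<close>, chosen so that each of its members meets only finitely many members of
  \<open>\<A>\<close>.\<close>

lemma regular_space_open_refinement:
  assumes reg: "regular_space X"
    and lf: "\<And>\<U>. open_cover X \<U> \<Longrightarrow> \<exists>\<A>. locally_finite_in X \<A> \<and> \<Union>\<A> = topspace X \<and> refines_cover \<A> \<U>"
    and \<U>: "open_cover X \<U>"
  shows "\<exists>\<V>. open_cover X \<V> \<and> refines_cover \<V> \<U> \<and> locally_finite_in X \<V>"
proof -
  obtain \<A> where \<A>: "locally_finite_in X \<A>" "\<Union>\<A> = topspace X" "refines_cover \<A> \<U>"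
    using lf[OF \<U>] by blast
  define \<O> where "\<O> = {W. openin X W \<and> finite {A\<in>\<A>. A \<inter> W \<noteq> {}}}"
  have "open_cover X \<O>"
    unfolding open_cover_def
  proof (intro conjI subset_antisym subsetI)
    fix x assume "x \<in> topspace X"
    then show "x \<in> \<Union>\<O>"
      using \<A>(1) unfolding locally_finite_in_def \<O>_def by blast
  qed (use openin_subset in \<open>auto simp: \<O>_def\<close>)
  then obtain \<F> where \<F>: "locally_finite_in X \<F>" "\<Union>\<F> = topspace X" "refines_cover \<F> \<O>"
      "\<And>F. F \<in> \<F> \<Longrightarrow> closedin X F"
    using regular_space_closed_refinement[OF reg lf] by metis
  have finF: "finite {A\<in>\<A>. A \<inter> F \<noteq> {}}" if F: "F \<in> \<F>" for F
  proof -
    obtain W where W: "F \<subseteq> W" "finite {A\<in>\<A>. A \<inter> W \<noteq> {}}"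
      using \<F>(3) F unfolding refines_cover_def \<O>_def by blast
    show ?thesis
      by (rule finite_subset[OF _ W(2)]) (use W(1) in blast)
  qed
  \<comment> \<open>The removed union is closed because \<open>\<F>\<close> is locally finite. A
    member of \<open>\<F>\<close> that meets \<open>star A\<close> must meet \<open>A\<close>, which
    transfers the finiteness from \<open>\<A>\<close> to its enlargements.\<close>
  define star where "star A = topspace X - \<Union>{F\<in>\<F>. F \<inter> A = {}}" for A
  have star_open: "openin X (star A)" for A
  proof -
    have "closedin X (\<Union>{F\<in>\<F>. F \<inter> A = {}})"
      using \<F> by (intro closedin_locally_finite_Union locally_finite_in_subset[OF \<F>(1)]) auto
    then show ?thesis
      unfolding star_def by (rule openin_diff[OF openin_topspace])
  qed
  have star_meets: "F \<inter> A \<noteq> {}" if "F \<in> \<F>" "F \<inter> star A \<noteq> {}" for F A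
    using that by (auto simp: star_def)
  have "\<forall>A\<in>\<A>. \<exists>U\<in>\<U>. A \<subseteq> U"
    using \<A>(3) unfolding refines_cover_def .
  then obtain U where U: "\<And>A. A \<in> \<A> \<Longrightarrow> U A \<in> \<U> \<and> A \<subseteq> U A"
    by metis
  let ?V = "(\<lambda>A. star A \<inter> U A) ` \<A>"
  have "locally_finite_family X \<A> star"
    unfolding locally_finite_family_def
  proof (intro conjI ballI)
    fix x assume "x \<in> topspace X"
    then obtain V where V: "openin X V" "x \<in> V" "finite {F\<in>\<F>. F \<inter> V \<noteq> {}}"
      using \<F>(1) unfolding locally_finite_in_def by blast
    have "{A\<in>\<A>. star A \<inter> V \<noteq> {}} \<subseteq> (\<Union>F\<in>{F\<in>\<F>. F \<inter> V \<noteq> {}}. {A\<in>\<A>. A \<inter> F \<noteq> {}})"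
    proof (rule subsetI)
      fix A assume "A \<in> {A\<in>\<A>. star A \<inter> V \<noteq> {}}"
      then obtain z where A: "A \<in> \<A>" and z: "z \<in> star A" "z \<in> V"
        by blast
      then obtain F where F: "F \<in> \<F>" "z \<in> F"
        using \<F>(2) V(1) openin_subset by blast
      then have "A \<inter> F \<noteq> {}"
        using star_meets z by blast
      then show "A \<in> (\<Union>F\<in>{F\<in>\<F>. F \<inter> V \<noteq> {}}. {A\<in>\<A>. A \<inter> F \<noteq> {}})"
        using A F z by blast
    qed
    then have "finite {A\<in>\<A>. star A \<inter> V \<noteq> {}}"
      by (rule finite_subset) (use V(3) finF in auto)
    then show "\<exists>V. openin X V \<and> x \<in> V \<and> finite {A\<in>\<A>. star A \<inter> V \<noteq> {}}"
      using V by blast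
  qed (auto simp: star_def)
  then have "locally_finite_in X ?V"
    by (rule locally_finite_family_image) simp
  moreover have "open_cover X ?V"
    unfolding open_cover_def
  proof (intro conjI ballI subset_antisym subsetI)
    fix V assume "V \<in> ?V"
    then obtain A where A: "A \<in> \<A>" "V = star A \<inter> U A"
      by blast
    then show "openin X V"
      using star_open[of A] U[OF A(1)] \<U> by (simp add: open_cover_def openin_Int)
  next
    fix x assume "x \<in> \<Union>?V"
    then show "x \<in> topspace X"
      by (auto simp: star_def)
  next
    fix x assume "x \<in> topspace X"
    then obtain A where A: "A \<in> \<A>" "x \<in> A"
      using \<A>(2) by blast
    then have "x \<in> star A \<inter> U A"
      using \<open>x \<in> topspace X\<close> U[OF A(1)] by (auto simp: star_def)
    with A(1) show "x \<in> \<Union>?V"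
      by blast
  qed
  moreover have "refines_cover ?V \<U>"
    unfolding refines_cover_def using U by blast
  ultimately show ?thesis by blast
qed

section \<open>Networks with locally finite open expansions\<close>

text \<open>Each member \<open>P\<close> of a family is paired with an open superset \<open>O\<close>; local finiteness is
  imposed on the supersets, counted with multiplicity.\<close>

definition expandable_pairs :: "'a topology \<Rightarrow> ('a set \<times> 'a set) set \<Rightarrow> bool" where
  "expandable_pairs X \<P> \<longleftrightarrow>
     locally_finite_family X \<P> snd \<and> (\<forall>p\<in>\<P>. fst p \<subseteq> snd p \<and> openin X (snd p))"

lemma expandable_pairs_locally_finite:
  "expandable_pairs X \<P> \<Longrightarrow> locally_finite_in X (fst ` \<P>)"
  unfolding expandable_pairs_def by (blast intro: locally_finite_family_image)

lemma finite_imp_expandable_pairs: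
  assumes "finite \<P>" "\<And>p. p \<in> \<P> \<Longrightarrow> fst p \<subseteq> snd p" "\<And>p. p \<in> \<P> \<Longrightarrow> openin X (snd p)"
  shows "expandable_pairs X \<P>"
  unfolding expandable_pairs_def locally_finite_family_def
proof (intro conjI ballI)
  fix x assume "x \<in> topspace X"
  then show "\<exists>V. openin X V \<and> x \<in> V \<and> finite {p \<in> \<P>. snd p \<inter> V \<noteq> {}}"
    using assms(1) by (intro exI[of _ "topspace X"]) auto
qed (simp_all add: assms openin_subset)

lemma expandable_pairs_Int:
  assumes \<P>: "expandable_pairs X \<P>" and \<Q>: "expandable_pairs X \<Q>"
  shows "expandable_pairs X ((\<lambda>(p, q). (fst p \<inter> fst q, snd p \<inter> snd q)) ` (\<P> \<times> \<Q>))" (is "expandable_pairs X ?R")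
  unfolding expandable_pairs_def
proof (intro conjI)
  show "\<forall>p\<in>?R. fst p \<subseteq> snd p \<and> openin X (snd p)"
    using assms unfolding expandable_pairs_def by (fastforce intro: openin_Int)
  show "locally_finite_family X ?R snd"
    unfolding locally_finite_family_def
  proof (intro conjI ballI)
    fix p assume "p \<in> ?R"
    then show "snd p \<subseteq> topspace X"
      using \<P> unfolding expandable_pairs_def locally_finite_family_def by fastforce
  next
    fix x assume x: "x \<in> topspace X"
    obtain V W where V: "openin X V" "x \<in> V" "finite {p\<in>\<P>. snd p \<inter> V \<noteq> {}}"
      and W: "openin X W" "x \<in> W" "finite {p\<in>\<Q>. snd p \<inter> W \<noteq> {}}"
      using \<P> \<Q> x unfolding expandable_pairs_def locally_finite_family_def by meson
    have "{p\<in>?R. snd p \<inter> (V \<inter> W) \<noteq> {}} \<subseteq> (\<lambda>(p, q). (fst p \<inter> fst q, snd p \<inter> snd q)) `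
        ({p\<in>\<P>. snd p \<inter> V \<noteq> {}} \<times> {p\<in>\<Q>. snd p \<inter> W \<noteq> {}})"
      by (fastforce simp: image_iff)
    then have "finite {p\<in>?R. snd p \<inter> (V \<inter> W) \<noteq> {}}"
      by (rule finite_subset) (use V W in auto)
    then show "\<exists>V. openin X V \<and> x \<in> V \<and> finite {p\<in>?R. snd p \<inter> V \<noteq> {}}"
      using V W by (intro exI[of _ "V \<inter> W"]) auto
  qed
qed

text \<open>For an open cover, keep the pairs \<open>p\<close> with \<open>fst p\<close> inside some
  member \<open>U p\<close>. The sets \<open>snd p \<inter> U p\<close> are open, refine the cover,
  inherit local finiteness from \<open>snd p\<close>, and cover the space because they contain
  \<open>fst p\<close>.\<close>

lemma expandable_network_imp_paracompact:
  fixes \<P> :: "nat \<Rightarrow> ('a set \<times> 'a set) set"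
  assumes reg: "regular_space X" and haus: "Hausdorff_space X"
    and \<P>: "\<And>n. expandable_pairs X (\<P> n)"
    and net: "\<And>U x. openin X U \<Longrightarrow> x \<in> U \<Longrightarrow> \<exists>n. \<exists>p\<in>\<P> n. x \<in> fst p \<and> fst p \<subseteq> U"
  shows "paracompact_space X"
proof -
  have "\<exists>\<A>. locally_finite_in X \<A> \<and> \<Union>\<A> = topspace X \<and> refines_cover \<A> \<U>" if \<U>: "open_cover X \<U>" for \<U>
  proof -
    define \<P>' where "\<P>' n = {p \<in> \<P> n. \<exists>U\<in>\<U>. fst p \<subseteq> U}" for n
    have "\<exists>U. \<forall>n. \<forall>p\<in>\<P>' n. U p \<in> \<U> \<and> fst p \<subseteq> U p"
      by (rule exI[of _ "\<lambda>p. SOME U. U \<in> \<U> \<and> fst p \<subseteq> U"]) (auto simp: \<P>'_def intro: someI2)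
    then obtain U where U: "\<And>n p. p \<in> \<P>' n \<Longrightarrow> U p \<in> \<U> \<and> fst p \<subseteq> U p"
      by blast
    define \<V> where "\<V> n = (\<lambda>p. snd p \<inter> U p) ` \<P>' n" for n
    have "locally_finite_in X (\<V> n)" for n
    proof -
      \<comment> \<open>The default value \<open>{}\<close> extends the family from
        \<open>\<P>' n\<close> to all of \<open>\<P> n\<close>, where local finiteness is known;
        restricting the image afterwards discards it.\<close>
      have "locally_finite_in X ((\<lambda>p. if p \<in> \<P>' n then snd p \<inter> U p else {}) ` \<P> n)"
        using \<P>[of n] unfolding expandable_pairs_def by (intro locally_finite_family_image) auto
      then show ?thesis
        by (rule locally_finite_in_subset) (auto simp: \<V>_def \<P>'_def)
    qed
    moreover have "openin X V" if "V \<in> \<V> n" for n V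
    proof -
      obtain p where p: "p \<in> \<P>' n" "V = snd p \<inter> U p"
        using \<open>V \<in> \<V> n\<close> unfolding \<V>_def by blast
      have "openin X (snd p)"
        using p(1) \<P>[of n] unfolding expandable_pairs_def \<P>'_def by blast
      moreover have "openin X (U p)"
        using U[OF p(1)] \<U> unfolding open_cover_def by blast
      ultimately show ?thesis
        using p(2) by (simp add: openin_Int)
    qed
    moreover have "topspace X \<subseteq> (\<Union>n. \<Union>(\<V> n))"
    proof
      fix x assume "x \<in> topspace X"
      then obtain U' where U': "U' \<in> \<U>" "x \<in> U'" "openin X U'"
        by (rule open_coverE[OF \<U>])
      then obtain n p where p: "p \<in> \<P> n" "x \<in> fst p" "fst p \<subseteq> U'"
        using net by blast
      then have "p \<in> \<P>' n"
        using U' by (auto simp: \<P>'_def)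
      moreover have "x \<in> snd p \<inter> U p"
        using p U[OF \<open>p \<in> \<P>' n\<close>] \<P>[of n] unfolding expandable_pairs_def by blast
      ultimately show "x \<in> (\<Union>n. \<Union>(\<V> n))"
        unfolding \<V>_def by blast
    qed
    ultimately obtain \<A> where "locally_finite_in X \<A>" "\<Union>\<A> = topspace X" "refines_cover \<A> (\<Union>n. \<V> n)"
      by (rule sigma_locally_finite_imp_locally_finite_refinement)
    moreover have "refines_cover (\<Union>n. \<V> n) \<U>"
      unfolding refines_cover_def \<V>_def using U by blast
    ultimately show ?thesis
      using refines_cover_trans by blast
  qed
  note open_ref = regular_space_open_refinement[OF reg this]
  show ?thesis
    unfolding paracompact_space_def
  proof (intro conjI allI impI haus)
    fix \<U> assume "(\<forall>U\<in>\<U>. openin X U) \<and> \<Union>\<U> = topspace X"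
    then have "open_cover X \<U>"
      by (simp add: open_cover_def)
    then obtain \<V> where "open_cover X \<V>" "refines_cover \<V> \<U>" "locally_finite_in X \<V>"
      using open_ref by metis
    then show "\<exists>\<V>. (\<forall>V\<in>\<V>. openin X V) \<and> \<Union>\<V> = topspace X \<and>
        (\<forall>V\<in>\<V>. \<exists>U\<in>\<U>. V \<subseteq> U) \<and> locally_finite_in X \<V>"
      unfolding open_cover_def refines_cover_def by (intro exI[of _ \<V>]) simp
  qed
qed

section \<open>Sequences of network elements shrinking to a compact set\<close>

text \<open>A countable substitute for a neighbourhood base at \<open>K\<close>, whose terms may
  fail to be open.\<close>

definition shrinks_to :: "'a topology \<Rightarrow> (nat \<Rightarrow> 'a set) \<Rightarrow> 'a set \<Rightarrow> bool" where
  "shrinks_to X S K \<longleftrightarrow> decseq S \<and> (\<forall>n. K \<subseteq> S n \<and> S n \<subseteq> topspace X) \<and>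
     (\<forall>U. openin X U \<and> K \<subseteq> U \<longrightarrow> (\<exists>n. S n \<subseteq> U))"

text \<open>By the definition of a \<open>k\<close>-network, a finite union of its members fits
  between \<open>K\<close> and any open set around \<open>K\<close>. There are countably many finite
  unions containing \<open>K\<close>; intersecting the first \<open>n + 1\<close> of them gives the
  decreasing sequence.\<close>

lemma countable_k_network_shrinking_sequences:
  assumes net: "k_network X \<N>" and cnt: "countable \<N>"
  obtains \<E> where "countable \<E>" "\<And>N. N \<in> \<E> \<Longrightarrow> N \<subseteq> topspace X"
    "\<And>K. compactin X K \<Longrightarrow> \<exists>S. range S \<subseteq> \<E> \<and> shrinks_to X S K"
proof -
  define \<D> where "\<D> = Union ` {\<F>. finite \<F> \<and> \<F> \<subseteq> \<N>}"
  \<comment> \<open>The empty family is excluded because its intersection is the whole type, which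
    may exceed \<open>topspace X\<close>.\<close>
  define \<E> where "\<E> = Inter ` ({\<G>. finite \<G> \<and> \<G> \<subseteq> \<D>} - {{}})"
  have "\<Union>\<N> \<subseteq> topspace X"
    using net unfolding k_network_def by blast
  then have sub\<D>: "M \<subseteq> topspace X" if "M \<in> \<D>" for M
    using that unfolding \<D>_def by blast
  have "countable \<D>"
    unfolding \<D>_def by (intro countable_image countable_Collect_finite_subset cnt)
  then have "countable \<E>"
    unfolding \<E>_def by (intro countable_image countable_Diff countable_Collect_finite_subset)
  moreover have sub\<E>: "N \<subseteq> topspace X" if "N \<in> \<E>" for N
  proof -
    obtain \<G> M where "N = \<Inter>\<G>" "M \<in> \<G>" "\<G> \<subseteq> \<D>"
      using \<open>N \<in> \<E>\<close> unfolding \<E>_def by blast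
    then show ?thesis
      using sub\<D> by blast
  qed
  moreover have "\<exists>S. range S \<subseteq> \<E> \<and> shrinks_to X S K" if K: "compactin X K" for K
  proof -
    have net': "\<exists>M\<in>\<D>. K \<subseteq> M \<and> M \<subseteq> U" if U: "openin X U" "K \<subseteq> U" for U
    proof -
      obtain \<F> where "finite \<F>" "\<F> \<subseteq> \<N>" "K \<subseteq> \<Union>\<F>" "\<Union>\<F> \<subseteq> U"
        using net K U unfolding k_network_def by meson
      then show ?thesis
        unfolding \<D>_def by (intro bexI[of _ "\<Union>\<F>"]) auto
    qed
    define \<M> where "\<M> = {M\<in>\<D>. K \<subseteq> M}"
    have \<M>: "\<M> \<noteq> {}" "countable \<M>"
      using net'[of "topspace X"] compactin_subset_topspace[OF K] \<open>countable \<D>\<close>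
      unfolding \<M>_def by auto
    define S where "S n = \<Inter>(from_nat_into \<M> ` {..n})" for n
    have in\<M>: "from_nat_into \<M> i \<in> \<D>" "K \<subseteq> from_nat_into \<M> i" for i
      using from_nat_into[OF \<M>(1), of i] by (simp_all add: \<M>_def)
    have "S n \<in> \<E>" for n
      unfolding S_def \<E>_def using in\<M> by (intro imageI) auto
    moreover have "\<exists>n. S n \<subseteq> U" if U: "openin X U" "K \<subseteq> U" for U
    proof -
      obtain M where M: "M \<in> \<M>" "M \<subseteq> U"
        using net'[OF U] unfolding \<M>_def by blast
      then obtain n where "from_nat_into \<M> n = M"
        using from_nat_into_surj[OF \<M>(2)] by blast
      then have "S n \<subseteq> M"
        unfolding S_def by auto
      then show ?thesis
        using M by blast
    qed
    moreover have "decseq S"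
      unfolding S_def decseq_def by (intro allI impI INT_anti_mono) auto
    moreover have "K \<subseteq> S n" for n
      unfolding S_def using in\<M> by blast
    ultimately show ?thesis
      unfolding shrinks_to_def using sub\<E> by (intro exI[of _ S]) auto
  qed
  ultimately show thesis
    by (rule that)
qed

text \<open>The adjoined points converge to \<open>K\<close>: a finite subcover of \<open>K\<close>
  contains some \<open>S k\<close>, hence every \<open>x i\<close> with
  \<open>\<nu> i \<ge> k\<close>, and only finitely many points remain to be covered.\<close>

lemma compactin_Un_shrinking:
  assumes K: "compactin X K" and S: "shrinks_to X S K"
    and x: "\<And>i. i \<in> I \<Longrightarrow> x i \<in> S (\<nu> i)" and fin: "\<And>k. finite {i\<in>I. \<nu> i < k}"
  shows "compactin X (K \<union> x ` I)"
  unfolding compactin_def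
proof (intro conjI allI impI)
  show "K \<union> x ` I \<subseteq> topspace X"
    using compactin_subset_topspace[OF K] S x unfolding shrinks_to_def by blast
  fix \<U> assume \<U>: "(\<forall>U\<in>\<U>. openin X U) \<and> K \<union> x ` I \<subseteq> \<Union>\<U>"
  then obtain \<F> where \<F>: "finite \<F>" "\<F> \<subseteq> \<U>" "K \<subseteq> \<Union>\<F>"
    using K unfolding compactin_def by (metis le_sup_iff)
  have "openin X (\<Union>\<F>)"
    using \<F> \<U> by blast
  then obtain k where k: "S k \<subseteq> \<Union>\<F>"
    using S \<F>(3) unfolding shrinks_to_def by blast
  let ?J = "{i\<in>I. \<nu> i < k}"
  have "\<forall>i\<in>?J. \<exists>U\<in>\<U>. x i \<in> U"
    using \<U> by blast
  then obtain u where u: "\<And>i. i \<in> ?J \<Longrightarrow> u i \<in> \<U> \<and> x i \<in> u i"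
    by metis
  have "x i \<in> \<Union>(\<F> \<union> u ` ?J)" if "i \<in> I" for i
  proof (cases "\<nu> i < k")
    case True
    then show ?thesis
      using u[of i] that by auto
  next
    case False
    then have "S (\<nu> i) \<subseteq> S k"
      using S unfolding shrinks_to_def decseq_def by simp
    then show ?thesis
      using x[OF that] k by blast
  qed
  then have "K \<union> x ` I \<subseteq> \<Union>(\<F> \<union> u ` ?J)"
    using \<F>(3) by blast
  then show "\<exists>\<F>. finite \<F> \<and> \<F> \<subseteq> \<U> \<and> K \<union> x ` I \<subseteq> \<Union>\<F>"
    using \<F> fin u by (intro exI[of _ "\<F> \<union> u ` ?J"]) auto
qed

section \<open>Finite intersections of subbasic sets in the compact-open topology\<close>

text \<open>For finite \<open>I\<close>, compact \<open>K i\<close> and open \<open>b i\<close>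
  these are the basic open sets. The sets \<open>K i\<close> are left arbitrary so that network
  members, built from non-compact sets, have the same form.\<close>

definition cell :: "'a topology \<Rightarrow> 'b topology \<Rightarrow> 'i set \<Rightarrow> ('i \<Rightarrow> 'a set) \<Rightarrow> ('i \<Rightarrow> 'b set) \<Rightarrow> ('a \<Rightarrow> 'b) set" where
  "cell X Y I K b = {f \<in> cont_maps X Y. \<forall>i\<in>I. f ` K i \<subseteq> b i}"

lemma cont_maps_apply: "f \<in> cont_maps X Y \<Longrightarrow> x \<in> topspace X \<Longrightarrow> f x \<in> topspace Y"
  unfolding cont_maps_def continuous_map_def by auto

lemma openin_compact_open_subbasic:
  assumes "compactin X K" "openin Y U"
  shows "openin (compact_open_topology X Y) {f \<in> cont_maps X Y. f ` K \<subseteq> U}"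
  unfolding compact_open_topology_def using assms by (intro topology_generated_by_Basis) blast

lemma openin_cell:
  assumes "finite I" "\<And>i. i \<in> I \<Longrightarrow> compactin X (K i)" "\<And>i. i \<in> I \<Longrightarrow> openin Y (b i)"
  shows "openin (compact_open_topology X Y) (cell X Y I K b)"
proof -
  have "cell X Y I K b = (\<Inter>i\<in>I. {f \<in> cont_maps X Y. f ` K i \<subseteq> b i}) \<inter> topspace (compact_open_topology X Y)"
    by (auto simp: cell_def)
  then show ?thesis
    using assms by (simp only:) (intro openin_INT openin_compact_open_subbasic)
qed

text \<open>A map leaves the cell because of a single point sent outside a closed
  \<open>b i\<close>, and this is an open condition since a singleton is compact.\<close>

lemma closedin_cell:
  assumes "\<And>i. i \<in> I \<Longrightarrow> K i \<subseteq> topspace X" "\<And>i. i \<in> I \<Longrightarrow> closedin Y (b i)"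
  shows "closedin (compact_open_topology X Y) (cell X Y I K b)"
  unfolding closedin_def
proof
  show "cell X Y I K b \<subseteq> topspace (compact_open_topology X Y)"
    by (auto simp: cell_def)
  define G where "G i x = {f \<in> cont_maps X Y. f ` {x} \<subseteq> topspace Y - b i}" for i x
  have "openin (compact_open_topology X Y) (G i x)" if "i \<in> I" "x \<in> K i" for i x
    unfolding G_def using assms that by (intro openin_compact_open_subbasic) auto
  then have "openin (compact_open_topology X Y) (\<Union>i\<in>I. \<Union>x\<in>K i. G i x)"
    by blast
  moreover have "topspace (compact_open_topology X Y) - cell X Y I K b = (\<Union>i\<in>I. \<Union>x\<in>K i. G i x)"
    using assms(1) by (auto simp: G_def cell_def cont_maps_apply subset_iff)
  ultimately show "openin (compact_open_topology X Y) (topspace (compact_open_topology X Y) - cell X Y I K b)"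
    by simp
qed

lemma Hausdorff_space_compact_open:
  assumes "Hausdorff_space Y"
  shows "Hausdorff_space (compact_open_topology X Y)"
  unfolding Hausdorff_space_def topspace_compact_open_topology
proof (intro allI impI)
  fix f g assume "f \<in> cont_maps X Y \<and> g \<in> cont_maps X Y \<and> f \<noteq> g"
  then have fg: "f \<in> cont_maps X Y" "g \<in> cont_maps X Y" and "f \<noteq> g"
    by auto
  \<comment> \<open>Extensionality forces distinct maps to differ inside
    \<open>topspace X\<close>.\<close>
  then obtain x where x: "x \<in> topspace X" "f x \<noteq> g x"
    unfolding cont_maps_def by (metis (no_types, lifting) extensionalityI mem_Collect_eq)
  then obtain U V where UV: "openin Y U" "openin Y V" "f x \<in> U" "g x \<in> V" "disjnt U V"
    using assms cont_maps_apply[OF fg(1)] cont_maps_apply[OF fg(2)] unfolding Hausdorff_space_def by metis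
  have "disjnt {f \<in> cont_maps X Y. f ` {x} \<subseteq> U} {f \<in> cont_maps X Y. f ` {x} \<subseteq> V}"
    using UV(5) unfolding disjnt_def by blast
  then show "\<exists>U V. openin (compact_open_topology X Y) U \<and> openin (compact_open_topology X Y) V \<and>
      f \<in> U \<and> g \<in> V \<and> disjnt U V"
    using UV fg x openin_compact_open_subbasic[of X "{x}" Y]
    by (intro exI[of _ "{f \<in> cont_maps X Y. f ` {x} \<subseteq> U}"] exI[of _ "{f \<in> cont_maps X Y. f ` {x} \<subseteq> V}"]) simp
qed

text \<open>A constraint with an arbitrary open target is split into finitely many with targets in
  the base: regularity and compactness cut \<open>K\<close> into compact pieces, each sent by
  \<open>f\<close> into one base member. The triples remember the level \<open>j\<close> of the
  target, and concatenating lists intersects cells.\<close>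

lemma compact_open_cell_base:
  fixes X :: "'a topology" and Y :: "'b topology" and B :: "nat \<Rightarrow> 'b set set"
  assumes reg: "regular_space X"
    and base: "\<And>U y. openin Y U \<Longrightarrow> y \<in> U \<Longrightarrow> \<exists>j. \<exists>b\<in>B j. y \<in> b \<and> b \<subseteq> U"
    and Bopen: "\<And>j b. b \<in> B j \<Longrightarrow> openin Y b"
    and W: "openin (compact_open_topology X Y) W" and f: "f \<in> W"
  obtains ts :: "('a set \<times> nat \<times> 'b set) list" where
    "\<And>K j b. (K, j, b) \<in> set ts \<Longrightarrow> compactin X K \<and> b \<in> B j \<and> f ` K \<subseteq> b"
    "cell X Y (set ts) fst (snd \<circ> snd) \<subseteq> W"
proof -
  have fC: "f \<in> cont_maps X Y"
    using openin_subset[OF W] f by auto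
  then have cf: "continuous_map X Y f"
    by (simp add: cont_maps_def)
  have gen: "generate_topology_on {{f \<in> cont_maps X Y. f ` K \<subseteq> U} |K U. compactin X K \<and> openin Y U} W"
    using W unfolding compact_open_topology_def by (rule openin_topology_generated_by)
  define P where "P ts \<longleftrightarrow> (\<forall>(K, j, b)\<in>set ts. compactin X K \<and> b \<in> B j \<and> f ` K \<subseteq> b)"
    for ts :: "('a set \<times> nat \<times> 'b set) list"
  define C where "C ts = cell X Y (set ts) fst (snd \<circ> snd)" for ts :: "('a set \<times> nat \<times> 'b set) list"
  have append: "P (ts @ us) \<longleftrightarrow> P ts \<and> P us" "C (ts @ us) = C ts \<inter> C us" for ts us
    by (simp_all add: P_def C_def cell_def ball_Un Int_def conj_ac)
  note gen
  then have "f \<in> W \<longrightarrow> (\<exists>ts. P ts \<and> C ts \<subseteq> W)"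
  proof (induction rule: generate_topology_on.induct)
    case Empty
    then show ?case by simp
  next
    case (Int V W)
    show ?case
    proof
      assume "f \<in> V \<inter> W"
      then obtain ts us where "P ts" "C ts \<subseteq> V" "P us" "C us \<subseteq> W"
        using Int.IH by auto
      then have "P (ts @ us) \<and> C (ts @ us) \<subseteq> V \<inter> W"
        unfolding append by auto
      then show "\<exists>ts. P ts \<and> C ts \<subseteq> V \<inter> W" ..
    qed
  next
    case (UN \<K>)
    show ?case
    proof
      assume "f \<in> \<Union>\<K>"
      then obtain V where V: "V \<in> \<K>" "f \<in> V"
        by blast
      then obtain ts where "P ts" "C ts \<subseteq> V"
        using UN.IH[OF V(1)] by auto
      then have "P ts \<and> C ts \<subseteq> \<Union>\<K>"
        using V(1) by auto
      then show "\<exists>ts. P ts \<and> C ts \<subseteq> \<Union>\<K>" ..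
    qed
  next
    case (Basis V)
    then obtain K U where K: "compactin X K" and U: "openin Y U" and V: "V = {f \<in> cont_maps X Y. f ` K \<subseteq> U}"
      by blast
    show ?case
    proof
      assume "f \<in> V"
      then have "\<forall>x\<in>K. \<exists>j b. b \<in> B j \<and> f x \<in> b \<and> b \<subseteq> U"
        using base[OF U] V by blast
      then obtain j b where b: "\<And>x. x \<in> K \<Longrightarrow> b x \<in> B (j x) \<and> f x \<in> b x \<and> b x \<subseteq> U"
        by metis
      have "\<exists>G. openin X G \<and> x \<in> G \<and> X closure_of G \<subseteq> {z \<in> topspace X. f z \<in> b x}" if x: "x \<in> K" for x
      proof (rule regular_space_closed_nbhd[OF reg])
        show "openin X {z \<in> topspace X. f z \<in> b x}"
          using cf Bopen b[OF x] by (intro openin_continuous_map_preimage) auto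
        show "x \<in> {z \<in> topspace X. f z \<in> b x}"
          using b[OF x] x compactin_subset_topspace[OF K] by auto
      qed blast
      then obtain G where G: "\<And>x. x \<in> K \<Longrightarrow> openin X (G x) \<and> x \<in> G x \<and>
          X closure_of G x \<subseteq> {z \<in> topspace X. f z \<in> b x}"
        by metis
      have "(\<forall>U\<in>G ` K. openin X U) \<and> K \<subseteq> \<Union>(G ` K)"
        using G by auto
      then have "\<exists>\<F>. finite \<F> \<and> \<F> \<subseteq> G ` K \<and> K \<subseteq> \<Union>\<F>"
        using K unfolding compactin_def by simp
      then obtain Q where Q: "finite Q" "Q \<subseteq> K" "K \<subseteq> \<Union>(G ` Q)"
        by (metis finite_subset_image)
      then obtain qs where qs: "set qs = Q"
        using finite_list by blast
      define ts where "ts = map (\<lambda>x. (X closure_of G x \<inter> K, j x, b x)) qs"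
      have ts: "set ts = (\<lambda>x. (X closure_of G x \<inter> K, j x, b x)) ` Q"
        by (simp add: ts_def qs)
      have "compactin X (X closure_of G x \<inter> K) \<and> b x \<in> B (j x) \<and> f ` (X closure_of G x \<inter> K) \<subseteq> b x"
        if "x \<in> Q" for x
      proof -
        have "x \<in> K"
          using that Q by blast
        then show ?thesis
          using G[of x] b[of x] K by (auto intro: closed_Int_compactin)
      qed
      then have "P ts"
        unfolding P_def ts by auto
      moreover have "C ts \<subseteq> V"
      proof
        fix g assume g: "g \<in> C ts"
        have "g z \<in> U" if z: "z \<in> K" for z
        proof -
          obtain x where x: "x \<in> Q" "z \<in> G x"
            using Q z by blast
          then have "z \<in> X closure_of G x"
            using G[of x] Q closure_of_subset[of "G x" X] openin_subset by blast
          then have "g z \<in> b x"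
            using g x that unfolding C_def cell_def ts by auto
          then show ?thesis
            using b[of x] x Q by blast
        qed
        then show "g \<in> V"
          using g V unfolding C_def cell_def by blast
      qed
      ultimately show "\<exists>ts. P ts \<and> C ts \<subseteq> V"
        by auto
    qed
  qed
  then obtain ts where "P ts" "C ts \<subseteq> W"
    using f by auto
  then show thesis
    by (intro that[of ts]) (fastforce simp: P_def C_def)+
qed

lemma regular_space_compact_open:
  assumes X: "regular_space X" and Y: "regular_space Y"
  shows "regular_space (compact_open_topology X Y)"
  unfolding neighbourhood_base_of_closedin[symmetric] neighbourhood_base_of
proof (intro allI impI)
  fix W f assume Wf: "openin (compact_open_topology X Y) W \<and> f \<in> W"
  then have fC: "f \<in> cont_maps X Y" and cf: "continuous_map X Y f"
    using openin_subset[of "compact_open_topology X Y" W] by (auto simp: cont_maps_def)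
  obtain ts :: "('a set \<times> nat \<times> 'b set) list" where
    ts: "\<And>K j b. (K, j, b) \<in> set ts \<Longrightarrow> compactin X K \<and> b \<in> Collect (openin Y) \<and> f ` K \<subseteq> b"
    and sub: "cell X Y (set ts) fst (snd \<circ> snd) \<subseteq> W"
    \<comment> \<open>Here the base is the trivial one: every level consists of all open
      sets.\<close>
    by (rule compact_open_cell_base[OF X, of Y "\<lambda>_. Collect (openin Y)" W f]) (use Wf in auto)
  have "\<forall>t\<in>set ts. \<exists>V D. openin Y V \<and> closedin Y D \<and> f ` fst t \<subseteq> V \<and> V \<subseteq> D \<and> D \<subseteq> snd (snd t)"
  proof
    fix t assume t: "t \<in> set ts"
    obtain K j b where [simp]: "t = (K, j, b)"
      by (cases t)
    have K: "compactin Y (f ` K)" "openin Y b" "f ` K \<subseteq> b"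
      using ts[of K j b] t image_compactin[OF _ cf] by auto
    then have "closedin Y (topspace Y - b)" "disjnt (f ` K) (topspace Y - b)"
      by (auto simp: disjnt_def)
    then obtain U V where "openin Y U" "openin Y V" "f ` K \<subseteq> U" "topspace Y - b \<subseteq> V" "disjnt U V"
      using regular_space_compact_closed_separation[OF Y K(1)] by metis
    then show "\<exists>V D. openin Y V \<and> closedin Y D \<and> f ` fst t \<subseteq> V \<and> V \<subseteq> D \<and> D \<subseteq> snd (snd t)"
      using openin_subset[of Y U] by (intro exI[of _ U] exI[of _ "topspace Y - V"]) (auto simp: disjnt_def)
  qed
  then obtain V D where VD: "\<And>t. t \<in> set ts \<Longrightarrow> openin Y (V t) \<and> closedin Y (D t) \<and> f ` fst t \<subseteq> V t \<and>
      V t \<subseteq> D t \<and> D t \<subseteq> snd (snd t)"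
    by metis
  have K: "compactin X (fst t)" if "t \<in> set ts" for t
    using ts that by (metis prod.collapse)
  have "openin (compact_open_topology X Y) (cell X Y (set ts) fst V)"
    using VD K by (intro openin_cell) auto
  moreover have "closedin (compact_open_topology X Y) (cell X Y (set ts) fst D)"
    using VD K compactin_subset_topspace by (intro closedin_cell) blast+
  moreover have "f \<in> cell X Y (set ts) fst V"
    using fC VD unfolding cell_def by blast
  moreover have "cell X Y (set ts) fst V \<subseteq> cell X Y (set ts) fst D"
    using VD unfolding cell_def by fast
  moreover have "cell X Y (set ts) fst D \<subseteq> W"
    using sub VD unfolding cell_def by fastforce
  ultimately show "\<exists>U V. openin (compact_open_topology X Y) U \<and> closedin (compact_open_topology X Y) V \<and>
      f \<in> U \<and> U \<subseteq> V \<and> V \<subseteq> W"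
    by blast
qed

section \<open>The network of the function space\<close>

text \<open>Evaluation at a single point of \<open>N\<close> already makes the sets \<open>{f. f ` N \<subseteq> b}\<close> locally finite,
  and it provides their open expansions. If \<open>N\<close> is empty, there is no such point, but then all these
  sets coincide with the whole space.\<close>

fun network_pairs ::
    "'a topology \<Rightarrow> 'b topology \<Rightarrow> (nat \<Rightarrow> 'b set set) \<Rightarrow> ('a set \<times> nat) list \<Rightarrow> (('a \<Rightarrow> 'b) set \<times> ('a \<Rightarrow> 'b) set) set"
  where
  "network_pairs X Y B [] = {(cont_maps X Y, cont_maps X Y)}"
| "network_pairs X Y B ((N, j) # L) =
     (\<lambda>(p, q). (fst p \<inter> fst q, snd p \<inter> snd q)) `
       ((\<lambda>b. ({f \<in> cont_maps X Y. f ` N \<subseteq> b},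
              {f \<in> cont_maps X Y. f ` (if N = {} then {} else {SOME x. x \<in> N}) \<subseteq> b})) ` B j \<times>
        network_pairs X Y B L)"

lemma expandable_pairs_subbasic:
  assumes lf: "locally_finite_in Y \<B>" and op: "\<And>b. b \<in> \<B> \<Longrightarrow> openin Y b" and N: "N \<subseteq> topspace X"
  shows "expandable_pairs (compact_open_topology X Y)
    ((\<lambda>b. ({f \<in> cont_maps X Y. f ` N \<subseteq> b},
          {f \<in> cont_maps X Y. f ` (if N = {} then {} else {SOME x. x \<in> N}) \<subseteq> b})) ` \<B>)"
    (is "expandable_pairs ?Z (?P ` \<B>)")
proof (cases "N = {}")
  case True
  have P: "p = (cont_maps X Y, cont_maps X Y)" if "p \<in> ?P ` \<B>" for p
    using that True by auto
  then have "?P ` \<B> \<subseteq> {(cont_maps X Y, cont_maps X Y)}"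
    by blast
  then have fin: "finite (?P ` \<B>)"
    by (rule finite_subset) simp
  have op: "openin ?Z (cont_maps X Y)"
    using openin_topspace[of ?Z] by simp
  show ?thesis
  proof (rule finite_imp_expandable_pairs[OF fin])
    fix p assume "p \<in> ?P ` \<B>"
    then have "p = (cont_maps X Y, cont_maps X Y)"
      by (rule P)
    then show "fst p \<subseteq> snd p" "openin ?Z (snd p)"
      using op by simp_all
  qed
next
  case False
  define x where "x = (SOME x. x \<in> N)"
  have "x \<in> N"
    unfolding x_def using False by (simp add: some_in_eq)
  then have x: "x \<in> topspace X"
    using N by blast
  have P: "?P = (\<lambda>b. ({f \<in> cont_maps X Y. f ` N \<subseteq> b}, {f \<in> cont_maps X Y. f ` {x} \<subseteq> b}))"
    using False by (simp add: x_def)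
  show ?thesis
    unfolding expandable_pairs_def
  proof (intro conjI)
    show "\<forall>p\<in>?P ` \<B>. fst p \<subseteq> snd p \<and> openin ?Z (snd p)"
      unfolding P using \<open>x \<in> N\<close> op x openin_compact_open_subbasic[of X "{x}" Y] by auto
    show "locally_finite_family ?Z (?P ` \<B>) snd"
      unfolding locally_finite_family_def
    proof (intro conjI ballI)
      fix f assume "f \<in> topspace ?Z"
      then have f: "f \<in> cont_maps X Y"
        by simp
      then obtain V where V: "openin Y V" "f x \<in> V" "finite {b \<in> \<B>. b \<inter> V \<noteq> {}}"
        using lf cont_maps_apply[OF f x] unfolding locally_finite_in_def by blast
      let ?G = "{f \<in> cont_maps X Y. f ` {x} \<subseteq> V}"
      \<comment> \<open>A map common to \<open>snd p\<close> and \<open>?G\<close> sends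
        \<open>x\<close> into \<open>b \<inter> V\<close>.\<close>
      have "{p \<in> ?P ` \<B>. snd p \<inter> ?G \<noteq> {}} \<subseteq> ?P ` {b \<in> \<B>. b \<inter> V \<noteq> {}}"
      proof (rule subsetI)
        fix p assume "p \<in> {p \<in> ?P ` \<B>. snd p \<inter> ?G \<noteq> {}}"
        then obtain b where b: "b \<in> \<B>" "p = ?P b" "snd p \<inter> ?G \<noteq> {}"
          by blast
        then have "b \<inter> V \<noteq> {}"
          using False by (auto simp: x_def)
        then show "p \<in> ?P ` {b \<in> \<B>. b \<inter> V \<noteq> {}}"
          using b by blast
      qed
      then have "finite {p \<in> ?P ` \<B>. snd p \<inter> ?G \<noteq> {}}"
        using V(3) finite_surj by blast
      moreover have "openin ?Z ?G"
        using x V(1) by (intro openin_compact_open_subbasic) auto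
      moreover have "f \<in> ?G"
        using f V(2) by simp
      ultimately show "\<exists>V. openin ?Z V \<and> f \<in> V \<and> finite {p \<in> ?P ` \<B>. snd p \<inter> V \<noteq> {}}"
        by blast
    qed auto
  qed
qed

lemma expandable_network_pairs:
  assumes "\<And>j. locally_finite_in Y (B j)" and "\<And>j b. b \<in> B j \<Longrightarrow> openin Y b"
    and "\<And>N j. (N, j) \<in> set L \<Longrightarrow> N \<subseteq> topspace X"
  shows "expandable_pairs (compact_open_topology X Y) (network_pairs X Y B L)"
  using assms(3)
proof (induction L)
  case Nil
  have "openin (compact_open_topology X Y) (cont_maps X Y)"
    using openin_topspace[of "compact_open_topology X Y"] by simp
  then show ?case
    by (intro finite_imp_expandable_pairs) auto
next
  case (Cons a L)
  obtain N j where a: "a = (N, j)"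
    by (cases a)
  show ?case
    unfolding a network_pairs.simps
    using Cons a assms(1,2) by (intro expandable_pairs_Int expandable_pairs_subbasic) auto
qed

text \<open>The list records only the sets \<open>T t\<close> and the levels of the targets. The
  targets themselves vary within their levels, so a single list indexes a whole locally finite
  family.\<close>

lemma cell_in_network_pairs:
  assumes "\<And>t. t \<in> set ts \<Longrightarrow> snd (snd t) \<in> B (fst (snd t))"
  shows "cell X Y (set ts) T (snd \<circ> snd) \<in> fst ` network_pairs X Y B (map (\<lambda>t. (T t, fst (snd t))) ts)"
  using assms
proof (induction ts)
  case Nil
  then show ?case by (simp add: cell_def)
next
  case (Cons t ts)
  let ?L = "map (\<lambda>t. (T t, fst (snd t))) ts"
  let ?b = "snd (snd t)"
  let ?x = "if T t = {} then {} else {SOME x. x \<in> T t}"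
  have IH: "cell X Y (set ts) T (snd \<circ> snd) \<in> fst ` network_pairs X Y B ?L"
    by (rule Cons.IH) (use Cons.prems in simp)
  then obtain q where q: "q \<in> network_pairs X Y B ?L" "cell X Y (set ts) T (snd \<circ> snd) = fst q"
    using IH by blast
  let ?p = "({f \<in> cont_maps X Y. f ` T t \<subseteq> ?b}, {f \<in> cont_maps X Y. f ` ?x \<subseteq> ?b})"
  have "cell X Y (set (t # ts)) T (snd \<circ> snd) = fst ?p \<inter> cell X Y (set ts) T (snd \<circ> snd)"
    by (auto simp: cell_def)
  then have eq: "cell X Y (set (t # ts)) T (snd \<circ> snd) = fst (fst ?p \<inter> fst q, snd ?p \<inter> snd q)"
    using q(2) by simp
  have "?b \<in> B (fst (snd t))"
    using Cons.prems by simp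
  then have "(fst ?p \<inter> fst q, snd ?p \<inter> snd q) \<in> network_pairs X Y B (map (\<lambda>t. (T t, fst (snd t))) (t # ts))"
    unfolding list.map network_pairs.simps using q(1)
    by (intro image_eqI[of _ _ "(?p, q)"] SigmaI) auto
  then show ?case
    unfolding eq by (rule imageI)
qed

section \<open>Cells along shrinking sequences and the accumulation property\<close>

text \<open>By continuity the preimage of \<open>b i\<close> is an open set around
  \<open>K i\<close>, so it contains some term of \<open>S i\<close>; finitely many indices admit a
  common bound.\<close>

lemma mem_shrinking_cell:
  fixes K :: "'i \<Rightarrow> 'a set" and S :: "'i \<Rightarrow> nat \<Rightarrow> 'a set"
  assumes fin: "finite I" and K: "\<And>i. i \<in> I \<Longrightarrow> compactin X (K i)" and b: "\<And>i. i \<in> I \<Longrightarrow> openin Y (b i)"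
    and S: "\<And>i. i \<in> I \<Longrightarrow> shrinks_to X (S i) (K i)"
    and g: "g \<in> cell X Y I K b"
  shows "\<exists>m. \<forall>n\<ge>m. g \<in> cell X Y I (\<lambda>i. S i n) b"
proof -
  have "\<exists>n. S i n \<subseteq> {x \<in> topspace X. g x \<in> b i}" if i: "i \<in> I" for i
  proof -
    have "openin X {x \<in> topspace X. g x \<in> b i}"
      using g b[OF i] by (intro openin_continuous_map_preimage) (auto simp: cell_def cont_maps_def)
    moreover have "K i \<subseteq> {x \<in> topspace X. g x \<in> b i}"
      using g i compactin_subset_topspace[OF K[OF i]] unfolding cell_def by blast
    ultimately show ?thesis
      using S[OF i] unfolding shrinks_to_def by blast
  qed
  then obtain n where n: "\<And>i. i \<in> I \<Longrightarrow> S i (n i) \<subseteq> {x \<in> topspace X. g x \<in> b i}"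
    by metis
  \<comment> \<open>For empty \<open>I\<close> the value of \<open>Max\<close> is unspecified, but
    then there is no constraint to check.\<close>
  have "g \<in> cell X Y I (\<lambda>i. S i k) b" if k: "Max (n ` I) \<le> k" for k
  proof -
    have "S i k \<subseteq> S i (n i)" if "i \<in> I" for i
    proof -
      have "n i \<le> k"
        using k fin that by (meson Max_ge finite_imageI image_eqI order_trans)
      then show ?thesis
        using S[OF that] unfolding shrinks_to_def decseq_def by blast
    qed
    then show ?thesis
      using n g unfolding cell_def by blast
  qed
  then show ?thesis by blast
qed

text \<open>If the cells \<open>A \<inter> cell (S n)\<close> were all finite, then each \<open>a \<in> A\<close> outside \<open>cell (S m)\<close> violates
  some constraint at a point of \<open>S n\<close> with \<open>n\<close> as large as possible. Adjoining these points to the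
  compact sets keeps them compact and yields a neighbourhood of \<open>f\<close> that meets \<open>A\<close> in a finite set.\<close>

lemma accumulation_in_cell:
  fixes K :: "'i \<Rightarrow> 'a set" and S :: "'i \<Rightarrow> nat \<Rightarrow> 'a set"
  assumes fin: "finite I" and K: "\<And>i. i \<in> I \<Longrightarrow> compactin X (K i)" and b: "\<And>i. i \<in> I \<Longrightarrow> openin Y (b i)"
    and S: "\<And>i. i \<in> I \<Longrightarrow> shrinks_to X (S i) (K i)"
    and f: "f \<in> cell X Y I K b" and acc: "accumulates_at (compact_open_topology X Y) A f"
  shows "\<exists>m. \<forall>n\<ge>m. infinite (cell X Y I (\<lambda>i. S i n) b \<inter> A)"
proof -
  define W where "W n = cell X Y I (\<lambda>i. S i n) b" for n
  have mono: "W m \<subseteq> W n" if "m \<le> n" for m n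
  proof -
    have "S i n \<subseteq> S i m" if "i \<in> I" for i
      using S[OF that] \<open>m \<le> n\<close> unfolding shrinks_to_def decseq_def by blast
    then show ?thesis
      unfolding W_def cell_def by blast
  qed
  have reach: "\<exists>n. g \<in> W n" if g: "g \<in> cell X Y I K b" for g
    using mem_shrinking_cell[OF fin K b S g] unfolding W_def by blast
  have "\<exists>m. infinite (W m \<inter> A)"
  proof (rule ccontr)
    assume "\<not> ?thesis"
    then have finW: "finite (W n \<inter> A)" for n
      by blast
    obtain m where m: "f \<in> W m"
      using reach[OF f] by blast
    define A' where "A' = cell X Y I K b \<inter> A - W m"
    \<comment> \<open>The sets \<open>W n\<close> increase and \<open>a\<close> is not in
      \<open>W m\<close>, so the least index exceeds \<open>m\<close> and the subtraction is
      genuine: \<open>\<nu> a\<close> is the last index at which \<open>a\<close> is still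
      outside.\<close>
    define \<nu> where "\<nu> a = (LEAST n. a \<in> W n) - 1" for a
    have \<nu>: "a \<notin> W (\<nu> a)" "a \<in> W (Suc (\<nu> a))" "m \<le> \<nu> a" if "a \<in> A'" for a
    proof -
      obtain n where n: "a \<in> W n"
        using reach \<open>a \<in> A'\<close> unfolding A'_def by blast
      have L: "a \<in> W (LEAST n. a \<in> W n)"
        using n by (rule LeastI)
      have "a \<notin> W m"
        using \<open>a \<in> A'\<close> by (simp add: A'_def)
      then have "m < (LEAST n. a \<in> W n)"
        using L mono[of "LEAST n. a \<in> W n" m] by (meson not_less subsetD)
      then show "a \<notin> W (\<nu> a)" "a \<in> W (Suc (\<nu> a))" "m \<le> \<nu> a"
        using L not_less_Least[of "\<nu> a" "\<lambda>n. a \<in> W n"] unfolding \<nu>_def by auto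
    qed
    have "\<forall>a\<in>A'. \<exists>i x. i \<in> I \<and> x \<in> S i (\<nu> a) \<and> a x \<notin> b i"
    proof
      fix a assume a: "a \<in> A'"
      then have "a \<in> cont_maps X Y"
        by (simp add: A'_def cell_def)
      then show "\<exists>i x. i \<in> I \<and> x \<in> S i (\<nu> a) \<and> a x \<notin> b i"
        using \<nu>(1)[OF a] unfolding W_def cell_def by blast
    qed
    then obtain i x where ix: "\<And>a. a \<in> A' \<Longrightarrow> i a \<in> I \<and> x a \<in> S (i a) (\<nu> a) \<and> a (x a) \<notin> b (i a)"
      by metis
    \<comment> \<open>Each \<open>a\<close> contributes its bad point only to the compact set of the
      constraint \<open>i a\<close> that it violates.\<close>
    define L where "L k = K k \<union> x ` {a\<in>A'. i a = k}" for k
    have compL: "compactin X (L k)" if k: "k \<in> I" for k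
      unfolding L_def
    proof (rule compactin_Un_shrinking[OF K[OF k] S[OF k]])
      show "x a \<in> S k (\<nu> a)" if "a \<in> {a\<in>A'. i a = k}" for a
        using ix that by blast
      fix n
      have "a \<in> W n" if "a \<in> A'" "\<nu> a < n" for a
        using \<nu>(2)[OF that(1)] mono[of "Suc (\<nu> a)" n] that(2) by auto
      then have "{a \<in> {a\<in>A'. i a = k}. \<nu> a < n} \<subseteq> W n \<inter> A"
        unfolding A'_def by blast
      then show "finite {a \<in> {a\<in>A'. i a = k}. \<nu> a < n}"
        using finW finite_subset by blast
    qed
    \<comment> \<open>This is where \<open>m \<le> \<nu> a\<close> matters: the adjoined points stay
      in \<open>S k m\<close>, where \<open>f\<close> satisfies the constraints, so \<open>f\<close>
      remains in the new cell.\<close>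
    have LS: "L k \<subseteq> S k m" if "k \<in> I" for k
    proof -
      have "S k n \<subseteq> S k m" if "m \<le> n" for n
        using S[OF \<open>k \<in> I\<close>] that unfolding shrinks_to_def decseq_def by blast
      moreover have "K k \<subseteq> S k m"
        using S[OF \<open>k \<in> I\<close>] unfolding shrinks_to_def by blast
      ultimately show ?thesis
        unfolding L_def using ix \<nu>(3) by blast
    qed
    have "openin (compact_open_topology X Y) (cell X Y I L b)"
      using fin compL b by (rule openin_cell)
    moreover have "f \<in> cell X Y I L b"
      using m LS unfolding W_def cell_def by blast
    ultimately have "nbhd_of (compact_open_topology X Y) f (cell X Y I L b)"
      unfolding nbhd_of_def using openin_subset by blast
    then have inf: "infinite (cell X Y I L b \<inter> A)"
      using acc unfolding accumulates_at_def by blast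
    \<comment> \<open>An element of \<open>A\<close> in the new cell but outside \<open>W m\<close>
      would belong to \<open>A'\<close>, and its own bad point, now part of \<open>L\<close>, would
      exclude it. Thus the neighbourhood meets \<open>A\<close> only inside the finite set
      \<open>W m \<inter> A\<close>.\<close>
    have "a \<in> W m" if a: "a \<in> cell X Y I L b" "a \<in> A" for a
    proof (rule ccontr)
      assume "a \<notin> W m"
      moreover have "a \<in> cell X Y I K b"
        using a(1) unfolding cell_def L_def by blast
      ultimately have "a \<in> A'"
        using a(2) by (simp add: A'_def)
      then have "x a \<in> L (i a)" "i a \<in> I" "a (x a) \<notin> b (i a)"
        using ix[of a] unfolding L_def by blast+
      then show False
        using a(1) unfolding cell_def by blast
    qed
    then have "cell X Y I L b \<inter> A \<subseteq> W m \<inter> A"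
      by blast
    then show False
      using finW inf finite_subset by blast
  qed
  then obtain m where m: "infinite (W m \<inter> A)"
    by blast
  have "infinite (W n \<inter> A)" if "m \<le> n" for n
    using m mono[OF that] by (meson Int_mono finite_subset order_refl)
  then show ?thesis
    unfolding W_def by blast
qed

text \<open>In a basic cell around \<open>f\<close> each compact set is replaced by a larger term of
  its shrinking sequence. Enlarging these sets shrinks the cell, which therefore stays inside
  \<open>W\<close>; for late terms it still contains \<open>f\<close> and, under accumulation,
  infinitely many elements of \<open>A\<close>.\<close>

lemma compact_open_network:
  fixes X :: "'a topology" and Y :: "'b topology" and B :: "nat \<Rightarrow> 'b set set"
  assumes reg: "regular_space X"
    and base: "\<And>U y. openin Y U \<Longrightarrow> y \<in> U \<Longrightarrow> \<exists>j. \<exists>b\<in>B j. y \<in> b \<and> b \<subseteq> U"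
    and Bopen: "\<And>j b. b \<in> B j \<Longrightarrow> openin Y b"
    and \<E>: "\<And>K. compactin X K \<Longrightarrow> \<exists>S. range S \<subseteq> \<E> \<and> shrinks_to X S K"
    and W: "openin (compact_open_topology X Y) W" "f \<in> W"
  shows "\<exists>L p. set L \<subseteq> \<E> \<times> UNIV \<and> p \<in> network_pairs X Y B L \<and> f \<in> fst p \<and> fst p \<subseteq> W \<and>
    (accumulates_at (compact_open_topology X Y) A f \<longrightarrow> infinite (fst p \<inter> A))"
proof -
  obtain ts :: "('a set \<times> nat \<times> 'b set) list" where
    ts: "\<And>K j b. (K, j, b) \<in> set ts \<Longrightarrow> compactin X K \<and> b \<in> B j \<and> f ` K \<subseteq> b"
    and sub: "cell X Y (set ts) fst (snd \<circ> snd) \<subseteq> W"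
    by (rule compact_open_cell_base[OF reg base Bopen W]) (assumption+, blast)
  let ?b = "snd \<circ> snd :: 'a set \<times> nat \<times> 'b set \<Rightarrow> 'b set"
  have t: "compactin X (fst t)" "?b t \<in> B (fst (snd t))" "f ` fst t \<subseteq> ?b t" if "t \<in> set ts" for t
    using ts[of "fst t" "fst (snd t)" "?b t"] that by auto
  then have bopen: "openin Y (?b t)" if "t \<in> set ts" for t
    using Bopen that by blast
  have "\<forall>t\<in>set ts. \<exists>S. range S \<subseteq> \<E> \<and> shrinks_to X S (fst t)"
    using t(1) \<E> by blast
  then obtain S where S: "\<And>t. t \<in> set ts \<Longrightarrow> range (S t) \<subseteq> \<E>"
      "\<And>t. t \<in> set ts \<Longrightarrow> shrinks_to X (S t) (fst t)"
    by metis
  have "f \<in> cont_maps X Y"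
    using openin_subset[OF W(1)] W(2) by auto
  then have f: "f \<in> cell X Y (set ts) fst ?b"
    using t(3) unfolding cell_def by blast
  let ?N = "\<lambda>n. cell X Y (set ts) (\<lambda>t. S t n) ?b"
  obtain m where m: "\<And>n. m \<le> n \<Longrightarrow> f \<in> ?N n"
    using mem_shrinking_cell[OF finite_set t(1) bopen S(2) f] by blast
  have "\<exists>k. \<forall>n\<ge>k. accumulates_at (compact_open_topology X Y) A f \<longrightarrow> infinite (?N n \<inter> A)"
    using accumulation_in_cell[OF finite_set t(1) bopen S(2) f] by blast
  then obtain k where
    k: "\<And>n. k \<le> n \<Longrightarrow> accumulates_at (compact_open_topology X Y) A f \<longrightarrow> infinite (?N n \<inter> A)"
    by blast
  define n where "n = max m k"
  let ?L = "map (\<lambda>t. (S t n, fst (snd t))) ts"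
  have "?N n \<in> fst ` network_pairs X Y B ?L"
    using t(2) by (intro cell_in_network_pairs) simp
  then obtain p where p: "p \<in> network_pairs X Y B ?L" "?N n = fst p"
    by blast
  have "S t n \<in> \<E>" if "t \<in> set ts" for t
    using S(1)[OF that] by blast
  then have "set ?L \<subseteq> \<E> \<times> UNIV"
    by auto
  moreover have "fst t \<subseteq> S t n" if "t \<in> set ts" for t
    using S(2)[OF that] unfolding shrinks_to_def by blast
  then have "?N n \<subseteq> W"
    using sub unfolding cell_def by fast
  moreover have "f \<in> ?N n" "accumulates_at (compact_open_topology X Y) A f \<longrightarrow> infinite (?N n \<inter> A)"
    using m k by (simp_all add: n_def)
  ultimately show ?thesis
    using p by (intro exI[of _ ?L] exI[of _ p]) simp
qed

theorem theorem1p4: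
  fixes X :: "'a topology" and Y :: "'b topology"
  assumes "aleph0_space X" and "metrizable_space Y"
  shows "paracompact_space (compact_open_topology X Y) \<and> P_space (compact_open_topology X Y)"
proof -
  let ?Z = "compact_open_topology X Y"
  obtain \<N> where reg: "regular_space X" and \<N>: "countable \<N>" "k_network X \<N>"
    using assms(1) unfolding aleph0_space_def by blast
  obtain \<E> where \<E>: "countable \<E>" "\<And>N. N \<in> \<E> \<Longrightarrow> N \<subseteq> topspace X"
      "\<And>K. compactin X K \<Longrightarrow> \<exists>S. range S \<subseteq> \<E> \<and> shrinks_to X S K"
    by (rule countable_k_network_shrinking_sequences[OF \<N>(2,1)]) blast
  obtain B :: "nat \<Rightarrow> 'b set set" where B: "\<And>j. locally_finite_in Y (B j)"
      "\<And>j b. b \<in> B j \<Longrightarrow> openin Y b"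
      "\<And>U y. openin Y U \<Longrightarrow> y \<in> U \<Longrightarrow> \<exists>j. \<exists>b\<in>B j. y \<in> b \<and> b \<subseteq> U"
    by (rule metrizable_space_sigma_locally_finite_base[OF assms(2)]) blast
  have regZ: "regular_space ?Z"
    using reg metrizable_imp_regular_space[OF assms(2)] by (rule regular_space_compact_open)
  have hausZ: "Hausdorff_space ?Z"
    using metrizable_imp_Hausdorff_space[OF assms(2)] by (rule Hausdorff_space_compact_open)
  \<comment> \<open>Finite lists over a countable set are countable, so enumerating them produces
    the sequence of locally finite families.\<close>
  define \<L> where "\<L> = lists (\<E> \<times> (UNIV :: nat set))"
  have \<L>: "countable \<L>" "\<L> \<noteq> {}"
    unfolding \<L>_def using \<E>(1) by auto
  define \<P> where "\<P> n = network_pairs X Y B (from_nat_into \<L> n)" for n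
  have exp: "expandable_pairs ?Z (\<P> n)" for n
  proof -
    have "set (from_nat_into \<L> n) \<subseteq> \<E> \<times> UNIV"
      using from_nat_into[OF \<L>(2), of n] unfolding \<L>_def by blast
    then have "N \<subseteq> topspace X" if "(N, j) \<in> set (from_nat_into \<L> n)" for N j
      using \<E>(2)[of N] that by blast
    then show ?thesis
      unfolding \<P>_def using B(1,2) by (intro expandable_network_pairs)
  qed
  have net: "\<exists>n. \<exists>p\<in>\<P> n. f \<in> fst p \<and> fst p \<subseteq> W \<and> (accumulates_at ?Z A f \<longrightarrow> infinite (fst p \<inter> A))"
    if W: "openin ?Z W" "f \<in> W" for W f A
  proof -
    have "\<exists>L p. set L \<subseteq> \<E> \<times> UNIV \<and> p \<in> network_pairs X Y B L \<and> f \<in> fst p \<and> fst p \<subseteq> W \<and>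
        (accumulates_at ?Z A f \<longrightarrow> infinite (fst p \<inter> A))"
      by (rule compact_open_network[OF reg B(3,2) \<E>(3) W]) assumption+
    then obtain L p where Lp: "set L \<subseteq> \<E> \<times> UNIV" "p \<in> network_pairs X Y B L" "f \<in> fst p" "fst p \<subseteq> W"
        "accumulates_at ?Z A f \<longrightarrow> infinite (fst p \<inter> A)"
      by metis
    have "L \<in> \<L>"
      using Lp(1) by (auto simp: \<L>_def)
    then obtain n where "from_nat_into \<L> n = L"
      using from_nat_into_surj[OF \<L>(1)] by blast
    then show ?thesis
      using Lp by (auto simp: \<P>_def)
  qed
  have "paracompact_space ?Z"
  proof (rule expandable_network_imp_paracompact[OF regZ hausZ])
    show "expandable_pairs ?Z (\<P> n)" for n
      by (rule exp)
    show "\<exists>n. \<exists>p\<in>\<P> n. f \<in> fst p \<and> fst p \<subseteq> W" if "openin ?Z W" "f \<in> W" for W f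
      using net[OF that] by blast
  qed
  moreover have "P_space ?Z"
    unfolding P_space_def
  proof (intro conjI exI)
    let ?N = "\<Union>n. fst ` \<P> n"
    have lf: "locally_finite_in ?Z (fst ` \<P> n)" for n
      using exp by (rule expandable_pairs_locally_finite)
    then show "sigma_locally_finite_in ?Z ?N"
      unfolding sigma_locally_finite_in_def by (intro exI[of _ "\<lambda>n. fst ` \<P> n"]) simp
    show "cp_network ?Z ?N"
      unfolding cp_network_def
    proof (intro conjI ballI allI impI)
      show "?N \<subseteq> Pow (topspace ?Z)"
        using lf unfolding locally_finite_in_def by blast
      fix f V A assume "nbhd_of ?Z f V \<and> A \<subseteq> topspace ?Z \<and> f \<in> ?Z closure_of A"
      then obtain W where W: "openin ?Z W" "f \<in> W" "W \<subseteq> V"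
        unfolding nbhd_of_def by blast
      obtain n p where "p \<in> \<P> n" "f \<in> fst p" "fst p \<subseteq> W"
          "accumulates_at ?Z A f \<longrightarrow> infinite (fst p \<inter> A)"
        using net[OF W(1,2), of A] by blast
      then show "\<exists>N\<in>?N. f \<in> N \<and> N \<subseteq> V \<and> (accumulates_at ?Z A f \<longrightarrow> infinite (N \<inter> A))"
        using W(3) by (intro bexI[of _ "fst p"]) auto
    qed
  qed (use regZ hausZ Hausdorff_imp_t1_space in auto)
  ultimately show ?thesis ..
qed

end
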